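(* Let $q\in\mathbb{C}^*$ with $0<|q|<1$. For any $x\in\mathbb{C}^*$, \[ \mathrm{A}_{q^2}\left(-\frac{q^3}{x^2}\right)=\frac{1}{(q,-1;q)_\infty}\left\{\theta_q\left(\frac{x}{q}\right)\mathrm{Ai}_q(-x)+\theta_q\left(-\frac{x}{q}\right)\mathrm{Ai}_q(x)\right\}. \] Here $\mathrm{A}_{q^2}$ is the Ramanujan function with base $q^2$, $\mathrm{Ai}_q$ is the $q$-Airy function and $\theta_q$ is the theta function of Jacobi.
   Context: Throughout $q\in\mathbb{C}^*$ satisfies $0<|q|<1$. The $q$-shifted factorial is $(a;q)_0=1$, $(a;q)_n=(1-a)(1-aq)\cdots(1-aq^{n-1})$ for $n\ge 1$, $(a;q)_\infty=\lim_{n\to\infty}(a;q)_n$, and $(a_1,\dots,a_m;q)_n=(a_1;q)_n\cdots(a_m;q)_n$ (also for $n=\infty$). The Ramanujan function with base $p$ ($0<|p|<1$) is the entire function \[\mathrm{A}_p(x)=\sum_{n\ge 0}\frac{p^{n^2}}{(p;p)_n}(-x)^n .\] The $q$-Airy function is the entire function \[\mathrm{Ai}_q(x)=\sum_{n\ge 0}\frac{1}{(-q;q)_n(q;q)_n}\left\{(-1)^nq^{\frac{n(n-1)}{2}}\right\}(-x)^n .\] The theta function of Jacobi is $\theta_q(x)=\sum_{n\in\mathbb{Z}}q^{\frac{n(n-1)}{2}}x^n$ for $x\in\mathbb{C}^*$. *)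

theory Defs
  imports "HOL-Analysis.Analysis"
begin

definition q_shifted_fact :: "complex \<Rightarrow> complex \<Rightarrow> nat \<Rightarrow> complex" where
  "q_shifted_fact a q n = (\<Prod>k<n. 1 - a * q ^ k)"

definition q_shifted_fact_inf :: "complex \<Rightarrow> complex \<Rightarrow> complex" where
  "q_shifted_fact_inf a q = lim (\<lambda>n. q_shifted_fact a q n)"

definition ramanujan_A :: "complex \<Rightarrow> complex \<Rightarrow> complex" where
  "ramanujan_A p x = (\<Sum>n. p ^ (n ^ 2) / q_shifted_fact p p n * (- x) ^ n)"

definition q_Airy :: "complex \<Rightarrow> complex \<Rightarrow> complex" where
  "q_Airy q x = (\<Sum>n. 1 / (q_shifted_fact (- q) q n * q_shifted_fact q q n)
      * ((- 1) ^ n * q ^ (n * (n - 1) div 2)) * (- x) ^ n)"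

text \<open>
  The bilateral series converges absolutely for \<open>0 < \<bar>q\<bar> < 1\<close> and \<open>x \<noteq> 0\<close>, so
  the unordered sum over the integers is the usual bilateral sum. The exponent
  \<open>n (n - 1) / 2\<close> is an integer, hence \<open>div\<close> is exact.
\<close>

definition jacobi_theta :: "complex \<Rightarrow> complex \<Rightarrow> complex" where
  "jacobi_theta q x = (\<Sum>\<^sub>\<infinity>n::int. q powi (n * (n - 1) div 2) * x powi n)"

end

theory Submission
  imports Defs
begin

text \<open>
  Put p = q^2. Since (-q;q)_n (q;q)_n = (p;p)_n, multiplying the theta series by the q-Airy series
  and collecting powers of x cancels the odd powers, and the coefficient of x^(2k) is
  2 q^(k(2k-3)) times the sum over n of (-1)^n p^(n(n-1)/2) p^((1-k)n) / (p;p)_n. By Euler's identity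
  this sum is (p^(1-k);p)_\<infinity>, which vanishes for k > 0 and equals (p;p)_\<infinity> / (p;p)_j for k = -j.
  What remains is the Ramanujan series, scaled by 2 (p;p)_\<infinity> = (q,-1;q)_\<infinity>.
\<close>

section \<open>Ratio test and triangular exponents\<close>

text \<open>The recurrence is multiplicative rather than a quotient of consecutive terms, so terms
  may vanish.\<close>

lemma summable_norm_ratio_tendsto_0:
  fixes a :: "nat \<Rightarrow> 'a::real_normed_field"
  assumes "\<And>n. a (Suc n) = r n * a n" and "r \<longlonglongrightarrow> 0"
  shows "summable (\<lambda>n. norm (a n))"
proof -
  have "eventually (\<lambda>n. norm (r n) < 1/2) sequentially"
    using tendsto_norm_zero[OF assms(2)] by (rule order_tendstoD) simp
  then obtain N where N: "\<And>n. n \<ge> N \<Longrightarrow> norm (r n) < 1/2"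
    by (auto simp: eventually_sequentially)
  show ?thesis
  proof (rule summable_ratio_test[of "1/2" N])
    fix n assume "N \<le> n"
    then have "norm (r n) * norm (a n) \<le> 1/2 * norm (a n)"
      using N[of n] by (intro mult_right_mono) auto
    then show "norm (norm (a (Suc n))) \<le> 1/2 * norm (norm (a n))"
      by (simp add: assms(1) norm_mult)
  qed simp
qed

lemma triangular_Suc: "Suc n * (Suc n - 1) div 2 = n * (n - 1) div 2 + n"
proof -
  have "Suc n * (Suc n - 1) = n * (n - 1) + 2 * n"
    by (cases n) auto
  then show ?thesis by simp
qed

lemma int_triangular: "int (n * (n - 1) div 2) = int n * (int n - 1) div 2"
  by (cases n) (simp_all add: zdiv_int algebra_simps)

lemma double_triangular: "2 * (m * (m - 1) div 2) = m * (m - 1)" for m :: int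
  by (rule dvd_mult_div_cancel) auto

section \<open>Finite q-shifted factorials\<close>

lemma q_shifted_fact_0 [simp]: "q_shifted_fact a q 0 = 1"
  by (simp add: q_shifted_fact_def)

lemma q_shifted_fact_Suc: "q_shifted_fact a q (Suc n) = (1 - a * q ^ n) * q_shifted_fact a q n"
  by (simp add: q_shifted_fact_def)

lemma q_shifted_fact_add:
  "q_shifted_fact a q (m + n) = q_shifted_fact a q m * q_shifted_fact (a * q ^ m) q n"
  by (induction n) (simp_all add: q_shifted_fact_Suc power_add algebra_simps)

text \<open>Factor by factor, (1 + q^(k+1)) (1 - q^(k+1)) = 1 - q^(2k+2). This brings the q-Airy
  denominators to base \<open>q ^ 2\<close>.\<close>

lemma q_shifted_fact_minus_mult:
  "q_shifted_fact (- q) q n * q_shifted_fact q q n = q_shifted_fact (q ^ 2) (q ^ 2) n"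
  by (induction n)
    (simp_all add: q_shifted_fact_Suc algebra_simps power2_eq_square power_mult_distrib)

lemma one_minus_power_neq_0:
  fixes q :: complex
  assumes "norm q < 1"
  shows "1 - q * q ^ n \<noteq> 0"
proof
  assume "1 - q * q ^ n = 0"
  then have "norm (q ^ Suc n) = 1" by simp
  then show False
    using assms power_less_one_iff[of "norm q" "Suc n"] by (simp add: norm_power del: power_Suc)
qed

lemma q_shifted_fact_neq_0: "norm q < 1 \<Longrightarrow> q_shifted_fact q q n \<noteq> 0"
  using one_minus_power_neq_0[of q] by (auto simp: q_shifted_fact_def)

section \<open>Theta-type series and Euler's identity\<close>

text \<open>The ratio of consecutive terms tends to 0. Should a factor of the denominator vanish,
  division by zero turns all later terms into 0 and the recurrence persists, so \<open>a\<close> is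
  arbitrary. The choice \<open>a = 0\<close> serves the theta series.\<close>

lemma summable_norm_theta_type:
  fixes q p a z :: complex
  assumes "norm q < 1" and "norm p < 1"
  shows "summable (\<lambda>n. norm (q ^ (n * (n - 1) div 2) * z ^ n / q_shifted_fact a p n))"
proof (rule summable_norm_ratio_tendsto_0)
  show "q ^ (Suc n * (Suc n - 1) div 2) * z ^ Suc n / q_shifted_fact a p (Suc n) =
      q ^ n * z / (1 - a * p ^ n) * (q ^ (n * (n - 1) div 2) * z ^ n / q_shifted_fact a p n)" for n
    unfolding triangular_Suc q_shifted_fact_Suc power_add by (simp add: field_simps)
  have "(\<lambda>n. q ^ n * z / (1 - a * p ^ n)) \<longlonglongrightarrow> 0 * z / (1 - a * 0)"
    by (intro tendsto_intros LIMSEQ_power_zero assms) auto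
  then show "(\<lambda>n. q ^ n * z / (1 - a * p ^ n)) \<longlonglongrightarrow> 0" by simp
qed

text \<open>Euler's expansion of (z;q)_\<infinity> in powers of \<open>z\<close>, kept apart from
  \<open>q_shifted_fact_inf\<close> until the two are shown to agree.\<close>

definition euler_series :: "complex \<Rightarrow> complex \<Rightarrow> complex" where
  "euler_series q z = (\<Sum>n. q ^ (n * (n - 1) div 2) * (- z) ^ n / q_shifted_fact q q n)"

lemma summable_euler_series:
  assumes "norm q < 1"
  shows "summable (\<lambda>n. q ^ (n * (n - 1) div 2) * (- z) ^ n / q_shifted_fact q q n)"
  by (rule summable_norm_cancel, rule summable_norm_theta_type) (use assms in auto)

text \<open>Subtracting the series at zq from that at z puts a factor 1 - q^n on the n-th term. It
  cancels the last factor of (q;q)_n and leaves -z times the preceding term of the series at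
  zq.\<close>

lemma euler_series_step:
  assumes "norm q < 1"
  shows "euler_series q z = (1 - z) * euler_series q (z * q)"
proof -
  define e where "e = (\<lambda>z n. q ^ (n * (n - 1) div 2) * (- z) ^ n / q_shifted_fact q q n)"
  have sm: "summable (e z)" for z
    unfolding e_def by (rule summable_euler_series[OF assms])
  have pw: "(- (z * q)) ^ k = q ^ k * (- z) ^ k" for k
    by (simp add: mult.commute flip: power_mult_distrib)
  have step: "e z (Suc n) - e (z * q) (Suc n) = - z * e (z * q) n" for n
  proof -
    have "e z (Suc n) - e (z * q) (Suc n) = (1 - q * q ^ n) * e z (Suc n)"
      unfolding e_def pw by (simp add: diff_divide_distrib algebra_simps)
    also have "\<dots> = - z * e (z * q) n"
      unfolding e_def pw triangular_Suc q_shifted_fact_Suc power_add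
      using one_minus_power_neq_0[OF assms, of n] q_shifted_fact_neq_0[OF assms, of n]
      by simp
    finally show ?thesis .
  qed
  have "suminf (e z) - suminf (e (z * q)) = (\<Sum>n. e z n - e (z * q) n)"
    by (rule suminf_diff[OF sm sm])
  \<comment> \<open>Both zeroth terms are 1 and cancel.\<close>
  also have "\<dots> = (\<Sum>n. e z (Suc n) - e (z * q) (Suc n))"
    using suminf_split_head[OF summable_diff[OF sm[of z] sm[of "z * q"]]] by (simp add: e_def)
  also have "\<dots> = - z * suminf (e (z * q))"
    unfolding step by (rule suminf_mult[OF sm])
  finally show ?thesis
    by (simp add: euler_series_def e_def algebra_simps)
qed

text \<open>
  Iterating the functional equation moves the argument to 0, where the series is continuous with
  value 1; this gives Euler's identity together with the convergence of the infinite product.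
\<close>
lemma tendsto_q_shifted_fact:
  assumes "norm q < 1"
  shows "q_shifted_fact z q \<longlonglongrightarrow> euler_series q z"
proof -
  have prod: "euler_series q z = q_shifted_fact z q n * euler_series q (z * q ^ n)" for n
    by (induction n)
      (simp_all add: q_shifted_fact_Suc euler_series_step[OF assms, of "z * q ^ _"] mult_ac)
  define c where "c = (\<lambda>n. q ^ (n * (n - 1) div 2) * (- 1) ^ n / q_shifted_fact q q n)"
  have series: "q ^ (n * (n - 1) div 2) * (- w) ^ n / q_shifted_fact q q n = c n * w ^ n" for n w
    by (simp add: c_def power_minus[of w])
  have "isCont (\<lambda>w. \<Sum>n. c n * w ^ n) 0"
    by (intro isCont_powser_converges_everywhere summable_euler_series[OF assms, unfolded series])
  moreover have "(\<lambda>n. z * q ^ n) \<longlonglongrightarrow> 0"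
    using assms tendsto_mult_right_zero[OF LIMSEQ_power_zero] by blast
  ultimately have "(\<lambda>n. \<Sum>k. c k * (z * q ^ n) ^ k) \<longlonglongrightarrow> (\<Sum>k. c k * 0 ^ k)"
    by (rule isCont_tendsto_compose)
  then have lim1: "(\<lambda>n. euler_series q (z * q ^ n)) \<longlonglongrightarrow> 1"
    unfolding euler_series_def series powser_zero by (simp add: c_def)
  then have "(\<lambda>n. euler_series q z / euler_series q (z * q ^ n)) \<longlonglongrightarrow> euler_series q z / 1"
    by (intro tendsto_intros) auto
  \<comment> \<open>The remaining factor tends to 1, hence is eventually nonzero, and the partial
    product is then the quotient whose limit is known.\<close>
  moreover have "eventually (\<lambda>n. euler_series q (z * q ^ n) \<noteq> 0) sequentially"
    using lim1 by (rule tendsto_imp_eventually_ne) simp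
  then have "eventually (\<lambda>n. euler_series q z / euler_series q (z * q ^ n) = q_shifted_fact z q n)
      sequentially"
    by eventually_elim (simp add: prod[symmetric] nonzero_divide_eq_eq)
  ultimately show ?thesis
    using tendsto_cong by force
qed

section \<open>Infinite q-shifted factorials\<close>

lemma q_shifted_fact_inf_eq:
  "norm q < 1 \<Longrightarrow> q_shifted_fact_inf z q = euler_series q z"
  unfolding q_shifted_fact_inf_def by (rule limI) (rule tendsto_q_shifted_fact)

text \<open>The product converges absolutely and has no zero factor, so its limit is nonzero. This
  permits the final division by (p;p)_\<infinity>.\<close>

lemma q_shifted_fact_inf_neq_0:
  assumes "norm q < 1"
  shows "q_shifted_fact_inf q q \<noteq> 0"
proof -
  have "summable (\<lambda>n. norm (q * q ^ n))"
    using assms by (simp add: norm_mult norm_power summable_mult summable_geometric)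
  then have "abs_convergent_prod (\<lambda>n. 1 - q * q ^ n)"
    by (simp add: abs_convergent_prod_conv_summable norm_minus_commute)
  then have "convergent_prod (\<lambda>n. 1 - q * q ^ n)"
    by (rule abs_convergent_prod_imp_convergent_prod)
  then obtain L where L: "(\<lambda>n. \<Prod>i\<le>n. 1 - q * q ^ i) \<longlonglongrightarrow> L" "L \<noteq> 0"
    using one_minus_power_neq_0[OF assms] by (subst (asm) convergent_prod_iff_nz_lim) auto
  have "(\<lambda>n. \<Prod>i\<le>n. 1 - q * q ^ i) \<longlonglongrightarrow> q_shifted_fact_inf q q"
    using LIMSEQ_Suc[OF tendsto_q_shifted_fact[OF assms, of q]]
    by (simp add: q_shifted_fact_inf_eq[OF assms] q_shifted_fact_def[abs_def] lessThan_Suc_atMost)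
  with L show ?thesis using LIMSEQ_unique by blast
qed

text \<open>The finite identity \<open>q_shifted_fact_add\<close> passes to the limit. It serves to
  expose a zero factor and to relate (p^(1+j);p)_\<infinity> to (p;p)_\<infinity>.\<close>

lemma q_shifted_fact_inf_split:
  assumes "norm q < 1"
  shows "q_shifted_fact_inf z q = q_shifted_fact z q n * q_shifted_fact_inf (z * q ^ n) q"
proof (rule LIMSEQ_unique)
  show "(\<lambda>m. q_shifted_fact z q (m + n)) \<longlonglongrightarrow> q_shifted_fact_inf z q"
    unfolding q_shifted_fact_inf_eq[OF assms]
    by (rule LIMSEQ_ignore_initial_segment[OF tendsto_q_shifted_fact[OF assms]])
  show "(\<lambda>m. q_shifted_fact z q (m + n)) \<longlonglongrightarrow>
      q_shifted_fact z q n * q_shifted_fact_inf (z * q ^ n) q"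
    unfolding q_shifted_fact_inf_eq[OF assms] add.commute[of _ n] q_shifted_fact_add
    by (intro tendsto_intros tendsto_q_shifted_fact[OF assms])
qed

text \<open>The first factor of (-1;q)_\<infinity> is 2; the others form (-q;q)_\<infinity>, which
  merges with (q;q)_\<infinity> into base \<open>q ^ 2\<close>.\<close>

lemma q_shifted_fact_inf_minus_one:
  assumes "norm q < 1"
  shows "q_shifted_fact_inf q q * q_shifted_fact_inf (- 1) q = 2 * q_shifted_fact_inf (q ^ 2) (q ^ 2)"
proof -
  have q2: "norm (q ^ 2) < 1"
    using assms by (simp add: norm_power power_less_one_iff)
  have "q_shifted_fact_inf (- q) q * q_shifted_fact_inf q q = q_shifted_fact_inf (q ^ 2) (q ^ 2)"
  proof (rule LIMSEQ_unique)
    show "(\<lambda>n. q_shifted_fact (- q) q n * q_shifted_fact q q n) \<longlonglongrightarrow>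
        q_shifted_fact_inf (- q) q * q_shifted_fact_inf q q"
      unfolding q_shifted_fact_inf_eq[OF assms]
      by (intro tendsto_intros tendsto_q_shifted_fact[OF assms])
    show "(\<lambda>n. q_shifted_fact (- q) q n * q_shifted_fact q q n) \<longlonglongrightarrow>
        q_shifted_fact_inf (q ^ 2) (q ^ 2)"
      unfolding q_shifted_fact_inf_eq[OF q2] q_shifted_fact_minus_mult
      by (rule tendsto_q_shifted_fact[OF q2])
  qed
  moreover have "q_shifted_fact_inf (- 1) q = 2 * q_shifted_fact_inf (- q) q"
    using q_shifted_fact_inf_split[OF assms, of "- 1" 1] by (simp add: q_shifted_fact_Suc)
  ultimately show ?thesis by (simp add: mult_ac)
qed

text \<open>The factor with index \<open>n\<close> is zero; splitting after \<open>Suc n\<close>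
  factors puts it into the finite part.\<close>

lemma q_shifted_fact_inf_eq_0:
  assumes "norm q < 1" and "z * q ^ n = 1"
  shows "q_shifted_fact_inf z q = 0"
  using q_shifted_fact_inf_split[OF assms(1), of z "Suc n"] assms(2)
  by (simp add: q_shifted_fact_Suc)

section \<open>The theta and q-Airy series as unordered sums, and their product\<close>

text \<open>Absolute summability of both factors makes the double family summable, so it may be
  summed along the lines m + n = N.\<close>

lemma has_sum_cauchy_product_int_nat:
  fixes c :: "int \<Rightarrow> complex" and d :: "nat \<Rightarrow> complex"
  assumes c: "(\<lambda>m. norm (c m)) summable_on UNIV" and d: "(\<lambda>n. norm (d n)) summable_on UNIV"
  shows "((\<lambda>N. \<Sum>\<^sub>\<infinity>n. c (N - int n) * d n) has_sum (infsum c UNIV * infsum d UNIV)) UNIV"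
proof -
  define f where "f = (\<lambda>(m, n). c m * d n)"
  have "(\<lambda>z. norm (f z)) summable_on Sigma UNIV (\<lambda>_. UNIV)"
    unfolding Infinite_Sum.abs_summable_on_Sigma_iff f_def using c d
    by (auto simp: norm_mult infsum_cmult_right' abs_mult
        intro!: summable_on_cmult_right summable_on_cmult_left)
  then have f: "f summable_on (UNIV \<times> UNIV)"
    by (rule abs_summable_summable)
  have "infsum f (UNIV \<times> UNIV) = infsum c UNIV * infsum d UNIV"
    using infsum_Sigma'_banach[of "\<lambda>m n. c m * d n" UNIV "\<lambda>_. UNIV"] f
    by (simp add: f_def infsum_cmult_right' infsum_cmult_left')
  with f have "(f has_sum (infsum c UNIV * infsum d UNIV)) (UNIV \<times> UNIV)"
    using has_sum_infsum by metis
  \<comment> \<open>The shear sending (m, n) to (m + n, n) is a bijection, with the total degree as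
    new first coordinate.\<close>
  then have g: "((\<lambda>(N, n). c (N - int n) * d n) has_sum (infsum c UNIV * infsum d UNIV)) (UNIV \<times> UNIV)"
    by (subst (asm) has_sum_reindex_bij_witness[where i = "\<lambda>(N, n). (N - int n, n)"
          and j = "\<lambda>(m, n). (m + int n, n)"]) (auto simp: f_def)
  then have "(\<lambda>(N, n). c (N - int n) * d n) summable_on (UNIV \<times> UNIV)"
    by (rule has_sum_imp_summable)
  then have "(\<lambda>n. c (N - int n) * d n) summable_on UNIV" for N
    by (rule summable_on_SigmaD1) simp
  then show ?thesis
    using has_sum_SigmaD[OF g] by auto
qed

text \<open>Both the nonnegative and the nonpositive integers give a one-sided theta-type series.
  The shared index 0 does no harm to summability.\<close>

lemma summable_norm_jacobi_theta:
  fixes q y :: complex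
  assumes "norm q < 1"
  shows "(\<lambda>m::int. norm (q powi (m * (m - 1) div 2) * y powi m)) summable_on UNIV"
proof -
  define f where "f = (\<lambda>m::int. norm (q powi (m * (m - 1) div 2) * y powi m))"
  have sm: "summable (\<lambda>n. norm (q ^ (n * (n - 1) div 2) * z ^ n))" for z
    using summable_norm_theta_type[OF assms, of 0 z 0] by (simp add: q_shifted_fact_def)
  have "f (int n) = norm (q ^ (n * (n - 1) div 2) * y ^ n)" for n
    unfolding f_def int_triangular[symmetric] by simp
  then have pos: "f summable_on range int"
    by (subst summable_on_reindex)
      (auto simp: o_def summable_on_UNIV_nonneg_real_iff intro: sm simp del: One_nat_def)
  \<comment> \<open>At -n the exponent is n(n-1)/2 + n; the surplus q^n combines with y^(-n), whence
    the argument \<open>q / y\<close>.\<close>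
  have "f (- int n) = norm (q ^ (n * (n - 1) div 2) * (q / y) ^ n)" for n
  proof -
    have "- int n * (- int n - 1) = int n * (int n - 1) + 2 * int n"
      by (simp add: algebra_simps)
    then have "- int n * (- int n - 1) div 2 = int (n * (n - 1) div 2 + n)"
      unfolding of_nat_add int_triangular by simp
    then show ?thesis
      unfolding f_def by (simp only: power_int_of_nat power_int_minus)
        (simp add: power_add power_divide field_simps)
  qed
  then have neg: "f summable_on range (\<lambda>n. - int n)"
    by (subst summable_on_reindex)
      (auto simp: o_def summable_on_UNIV_nonneg_real_iff inj_on_def intro: sm simp del: One_nat_def)
  have "range int \<union> range (\<lambda>n. - int n) = UNIV"
    by (auto simp: image_iff) (metis int_cases2)
  then show ?thesis
    using summable_on_union[OF pos neg] by (simp add: f_def)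
qed

text \<open>The two alternating signs cancel, and the denominators combine to base
  \<open>q ^ 2\<close>.\<close>

lemma q_Airy_eq:
  "q_Airy q x = (\<Sum>n. q ^ (n * (n - 1) div 2) * x ^ n / q_shifted_fact (q ^ 2) (q ^ 2) n)"
proof -
  have "1 / d * ((- 1) ^ n * y) * (- x) ^ n = y * x ^ n / d" for d y n
  proof -
    have "(- 1) ^ n * (- x) ^ n = x ^ n"
      by (simp flip: power_mult_distrib)
    then have "y * ((- 1) ^ n * (- x) ^ n) / d = y * x ^ n / d"
      by (rule arg_cong)
    then show ?thesis by (simp only: mult_ac times_divide_eq_left times_divide_eq_right mult_1)
  qed
  then show ?thesis
    unfolding q_Airy_def q_shifted_fact_minus_mult by (simp only:)
qed

lemma infsum_eq_suminf:
  fixes f :: "nat \<Rightarrow> complex"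
  assumes "summable (\<lambda>n. norm (f n))"
  shows "infsum f UNIV = suminf f"
  using norm_summable_imp_has_sum[OF assms summable_sums[OF summable_norm_cancel[OF assms]]]
  by (rule infsumI)

section \<open>Even coefficients of the product\<close>

text \<open>The total exponent of q is k(2k-3) + n(n-1) + 2(1-k)n. Its part depending on n is even,
  which gives Euler's series in base \<open>q ^ 2\<close>; the sign (-1)^n comes from
  \<open>(- x) ^ n\<close>.\<close>

lemma theta_Airy_coeff_eq_euler_series:
  fixes q x :: complex
  assumes "q \<noteq> 0" and "norm q < 1" and "x \<noteq> 0"
  shows "(\<Sum>\<^sub>\<infinity>n. q powi ((2 * k - int n) * (2 * k - int n - 1) div 2) * (x / q) powi (2 * k - int n) *
      (q ^ (n * (n - 1) div 2) * (- x) ^ n / q_shifted_fact (q ^ 2) (q ^ 2) n)) =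
    x powi (2 * k) * q powi (k * (2 * k - 3)) * euler_series (q ^ 2) ((q ^ 2) powi (1 - k))"
    (is "infsum ?f UNIV = _")
proof -
  let ?p = "q ^ 2"
  let ?z = "?p powi (1 - k)"
  have p: "norm ?p < 1"
    using assms(2) by (simp add: norm_power power_less_one_iff)
  define e where "e = (\<lambda>n. ?p ^ (n * (n - 1) div 2) * (- ?z) ^ n / q_shifted_fact ?p ?p n)"
  have term_eq: "?f n = x powi (2 * k) * q powi (k * (2 * k - 3)) * e n" for n
  proof -
    define t where "t = int (n * (n - 1) div 2)"
    define u where "u = (2 * k - int n) * (2 * k - int n - 1) div 2"
    have t: "2 * t = int n * (int n - 1)"
      unfolding t_def int_triangular by (rule double_triangular)
    have u: "2 * u = (2 * k - int n) * (2 * k - int n - 1)"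
      unfolding u_def by (rule double_triangular)
    have ex: "u - (2 * k - int n) + t = k * (2 * k - 3) + (2 * t + 2 * ((1 - k) * int n))"
    proof -
      \<comment> \<open>Only \<open>2 * u\<close> and \<open>2 * t\<close> are available as
        polynomials, so the identity is checked after doubling.\<close>
      have "2 * (u - (2 * k - int n) + t) = 2 * u - 2 * (2 * k - int n) + 2 * t" by simp
      also have "\<dots> = 2 * (k * (2 * k - 3) + (2 * t + 2 * ((1 - k) * int n)))"
        unfolding u distrib_left t by (simp add: algebra_simps)
      finally show ?thesis by simp
    qed
    have xx: "x powi (2 * k - int n) * x ^ n = x powi (2 * k)"
      using assms(3) by (simp add: power_int_diff)
    have qq: "q powi u * (1 / q powi (2 * k - int n)) * q ^ (n * (n - 1) div 2) =
        q powi (k * (2 * k - 3)) * (?p ^ (n * (n - 1) div 2) * ?z ^ n)"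
    proof -
      have "q powi u * (1 / q powi (2 * k - int n)) * q ^ (n * (n - 1) div 2) =
          q powi (u - (2 * k - int n) + t)"
        using assms(1) by (simp add: power_int_add power_int_diff t_def)
      also have "\<dots> = q powi (k * (2 * k - 3)) * (q powi (2 * t) * q powi (2 * ((1 - k) * int n)))"
        unfolding ex using assms(1) by (simp add: power_int_add)
      also have "q powi (2 * t) = ?p ^ (n * (n - 1) div 2)"
        unfolding t_def by (simp add: power_int_mult)
      also have "q powi (2 * ((1 - k) * int n)) = ?z ^ n"
        by (simp add: power_int_mult)
      finally show ?thesis .
    qed
    have "?f n = (q powi u * (1 / q powi (2 * k - int n)) * q ^ (n * (n - 1) div 2)) *
        (x powi (2 * k - int n) * x ^ n) * (- 1) ^ n / q_shifted_fact ?p ?p n"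
      by (simp add: u_def[symmetric] power_int_divide_distrib power_minus[of x])
    also have "\<dots> = x powi (2 * k) * q powi (k * (2 * k - 3)) * e n"
      unfolding qq xx e_def by (simp add: power_minus[of ?z])
    finally show ?thesis .
  qed
  have "summable (\<lambda>n. norm (e n))"
    unfolding e_def by (rule summable_norm_theta_type[OF p p])
  then have "infsum e UNIV = euler_series ?p ?z"
    unfolding euler_series_def e_def by (rule infsum_eq_suminf)
  then show ?thesis
    unfolding term_eq infsum_cmult_right' by simp
qed

section \<open>Collecting the surviving coefficients\<close>

theorem theorem1:
  fixes q x :: complex
  assumes "0 < norm q" and "norm q < 1" and "x \<noteq> 0"
  shows "ramanujan_A (q ^ 2) (- (q ^ 3 / x ^ 2)) =
    1 / (q_shifted_fact_inf q q * q_shifted_fact_inf (- 1) q) *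
    (jacobi_theta q (x / q) * q_Airy q (- x) + jacobi_theta q (- (x / q)) * q_Airy q x)"
proof -
  let ?p = "q ^ 2"
  have q: "q \<noteq> 0" using assms(1) by auto
  have p: "norm ?p < 1"
    using assms(2) by (simp add: norm_power power_less_one_iff)
  define P where "P = q_shifted_fact_inf ?p ?p"
  have P: "P \<noteq> 0" unfolding P_def by (rule q_shifted_fact_inf_neq_0[OF p])
  define a where "a = (\<lambda>y m. q powi (m * (m - 1) div 2) * y powi m)"
  define b where "b = (\<lambda>y n. q ^ (n * (n - 1) div 2) * y ^ n / q_shifted_fact ?p ?p n)"
  have a: "(\<lambda>m. norm (a y m)) summable_on UNIV" "infsum (a y) UNIV = jacobi_theta q y" for y
    unfolding a_def by (rule summable_norm_jacobi_theta[OF assms(2)]) (simp add: jacobi_theta_def)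
  have b: "summable (\<lambda>n. norm (b y n))" for y
    unfolding b_def by (rule summable_norm_theta_type[OF assms(2) p])
  have b': "(\<lambda>n. norm (b y n)) summable_on UNIV" "infsum (b y) UNIV = q_Airy q y" for y
    using b[of y] infsum_eq_suminf[OF b[of y]]
    by (auto simp: summable_on_UNIV_nonneg_real_iff q_Airy_eq b_def)
  define S where "S = jacobi_theta q (x / q) * q_Airy q (- x) + jacobi_theta q (- (x / q)) * q_Airy q x"
  define c where "c = (\<lambda>N. \<Sum>\<^sub>\<infinity>n. a (x / q) (N - int n) * b (- x) n)"
  \<comment> \<open>Changing the sign of \<open>x\<close> multiplies the part of degree
    \<open>N\<close> by (-1)^N, so the two products add up to
    \<open>c N + (- 1) powi N * c N\<close>.\<close>
  have flip: "a (- (x / q)) (N - int n) * b x n =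
      (- 1) powi N * (a (x / q) (N - int n) * b (- x) n)" for N n
  proof -
    have "(- (x / q)) powi (N - int n) = (- 1) powi (N - int n) * (x / q) powi (N - int n)"
      by (metis mult_minus1 power_int_mult_distrib)
    also have "(- 1) powi (N - int n) = (- 1) powi N * (- 1 :: complex) ^ n"
      by (simp add: power_int_diff divide_simps flip: power_mult_distrib)
    finally show ?thesis
      by (simp add: a_def b_def power_minus[of x])
  qed
  have "((\<lambda>N. c N + (- 1) powi N * c N) has_sum S) UNIV"
    unfolding S_def a(2)[symmetric] b'(2)[symmetric]
    using has_sum_add[OF has_sum_cauchy_product_int_nat[OF a(1)[of "x / q"] b'(1)[of "- x"]]
        has_sum_cauchy_product_int_nat[OF a(1)[of "- (x / q)"] b'(1)[of x]]]
    unfolding flip infsum_cmult_right' c_def .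
  moreover have c_even: "c (2 * k) =
      x powi (2 * k) * q powi (k * (2 * k - 3)) * q_shifted_fact_inf (?p powi (1 - k)) ?p" for k
    unfolding c_def a_def b_def q_shifted_fact_inf_eq[OF p]
    by (rule theta_Airy_coeff_eq_euler_series[OF q assms(2,3)])
  have inj: "inj (\<lambda>j. - 2 * int j)"
    by (auto simp: inj_on_def)
  have c_zero: "c N + (- 1) powi N * c N = 0" if "N \<notin> range (\<lambda>j. - 2 * int j)" for N
  proof (cases "even N")
    case False
    then show ?thesis by (simp add: power_int_minus_left)
  next
    case True
    then obtain k where k: "N = 2 * k" by auto
    have "k > 0"
    proof (rule ccontr)
      assume "\<not> k > 0"
      then have "N = - 2 * int (nat (- k))" using k by simp
      with that show False by blast
    qed
    \<comment> \<open>For k > 0 the factor of (p^(1-k);p)_\<infinity> with index k - 1 is 1 - 1 =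
      0.\<close>
    then have "?p powi (1 - k) * ?p ^ nat (k - 1) = ?p powi (1 - k + int (nat (k - 1)))"
      using q \<open>k > 0\<close> by (subst power_int_add) (auto simp: power_int_nonneg_exp)
    also have "\<dots> = 1" using \<open>k > 0\<close> by simp
    finally have "q_shifted_fact_inf (?p powi (1 - k)) ?p = 0"
      by (rule q_shifted_fact_inf_eq_0[OF p])
    then show ?thesis using c_even[of k] k by simp
  qed
  have c_val: "c (- 2 * int j) + (- 1) powi (- 2 * int j) * c (- 2 * int j) =
      2 * P * (?p ^ (j ^ 2) / q_shifted_fact ?p ?p j * (q ^ 3 / x ^ 2) ^ j)" for j
  proof -
    \<comment> \<open>Removing the first \<open>j\<close> factors of (p;p)_\<infinity> leaves the
      product starting at p^(1+j), the value of p^(1-k) at k = -j.\<close>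
    have "P = q_shifted_fact ?p ?p j * q_shifted_fact_inf (?p powi (1 + int j)) ?p"
      unfolding P_def q_shifted_fact_inf_split[OF p, of ?p j] using q by (simp add: power_int_add)
    then have 1: "q_shifted_fact_inf (?p powi (1 + int j)) ?p = P / q_shifted_fact ?p ?p j"
      using q_shifted_fact_neq_0[OF p, of j] by simp
    have 2: "x powi (- 2 * int j) = 1 / (x ^ 2) ^ j"
      by (simp add: power_int_minus divide_inverse power_int_mult flip: power_mult)
    \<comment> \<open>The summand 2j^2 yields the Ramanujan weight p^(j^2), and 3j yields the q^3 in
      the argument.\<close>
    have "- int j * (2 * - int j - 3) = int (2 * j ^ 2 + 3 * j)"
      by (simp add: algebra_simps power2_eq_square)
    then have 3: "q powi (- int j * (2 * - int j - 3)) = ?p ^ (j ^ 2) * (q ^ 3) ^ j"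
      by (simp only: power_int_of_nat) (simp add: power_add power_mult)
    have "c (- 2 * int j) = P * (?p ^ (j ^ 2) / q_shifted_fact ?p ?p j * (q ^ 3 / x ^ 2) ^ j)"
      using c_even[of "- int j"] 1 2 3 by (simp add: power_divide mult_ac)
    moreover have "(- 1 :: complex) powi (- 2 * int j) = 1"
      by (simp add: power_int_minus_left)
    ultimately show ?thesis by simp
  qed
  ultimately have "((\<lambda>N. c N + (- 1) powi N * c N) has_sum S) (range (\<lambda>j. - 2 * int j))"
    by (subst (asm) has_sum_cong_neutral[where T = "range (\<lambda>j. - 2 * int j)"]) (use c_zero in auto)
  then have "((\<lambda>j. 2 * P * (?p ^ (j ^ 2) / q_shifted_fact ?p ?p j * (q ^ 3 / x ^ 2) ^ j)) has_sum S) UNIV"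
    unfolding has_sum_reindex[OF inj] o_def c_val .
  then have "(\<lambda>j. 2 * P * (?p ^ (j ^ 2) / q_shifted_fact ?p ?p j * (q ^ 3 / x ^ 2) ^ j)) sums S"
    by (rule has_sum_imp_sums)
  \<comment> \<open>The divisor is (q,-1;q)_\<infinity> by
    \<open>q_shifted_fact_inf_minus_one\<close>.\<close>
  from sums_divide[OF this, of "2 * P"]
  have "ramanujan_A ?p (- (q ^ 3 / x ^ 2)) = S / (2 * P)"
    unfolding ramanujan_A_def using P by (auto simp: sums_iff)
  then show ?thesis
    unfolding q_shifted_fact_inf_minus_one[OF assms(2)] S_def P_def by simp
qed

end
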